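(* Let $\sigma\in S_k$ be a simple involution avoiding the pattern $4321$, with $k\ge 3$. Let $\alpha_1,\dots,\alpha_k$ be nonempty permutations such that the inflation $\pi=\sigma[\alpha_1,\dots,\alpha_k]$ is an involution avoiding $4321$. Then: (i) for every fixed point $i$ of $\sigma$, $\alpha_i$ is an identity permutation $1\,2\,\cdots\,m_i$; (ii) for every $i$ with $\sigma(i)\neq i$, $\alpha_i=\alpha_{\sigma(i)}^{-1}=\alpha_{\sigma(i)}=1\,2\,\cdots\,m_i$ for some $m_i\ge 1$. In particular all such inflations are obtained by replacing fixed points of $\sigma$ by blocks of fixed points and by replacing both entries of each transposition $(i,\sigma(i))$ of $\sigma$ by increasing blocks of the same length.
   Context: A permutation $\pi\in S_n$ avoids a pattern $s\in S_k$ if no subsequence of $\pi$ is order-isomorphic to $s$. An involution is a permutation equal to its own inverse. An interval of $\pi\in S_n$ is a set of contiguous positions $[a,b]$ whose image $\{\pi(i):a\le i\le b\}$ is a set of contiguous integers; $\pi$ is simple if its only intervals are the empty set, singletons and $[1,n]$. For $\sigma\in S_k$ and permutations $\alpha_1,\dots,\alpha_k$, the inflation $\sigma[\alpha_1,\dots,\alpha_k]$ is obtained by replacing the entry $\sigma(i)$ by a block of consecutive positions with consecutive values order-isomorphic to $\alpha_i$, the blocks being arranged relative to each other as the entries of $\sigma$. *)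

theory Defs
  imports "HOL-Combinatorics.Permutations"
begin

text \<open>
  A permutation of length \<open>n\<close> is a function \<open>p :: nat \<Rightarrow> nat\<close> with \<open>p permutes {1..n}\<close>. Such a function
  is the identity outside \<open>{1..n}\<close> and does not determine \<open>n\<close>, so lengths are passed explicitly;
  the identity permutation of any length is \<open>id\<close>.
\<close>

definition one_line :: "nat list \<Rightarrow> nat \<Rightarrow> nat" where
  "one_line w i = (if i \<in> {1..length w} then w ! (i - 1) else i)"

definition contains :: "nat \<Rightarrow> (nat \<Rightarrow> nat) \<Rightarrow> nat \<Rightarrow> (nat \<Rightarrow> nat) \<Rightarrow> bool" where
  "contains n p k s \<longleftrightarrow>
     (\<exists>f. strict_mono_on {1..k} f \<and> f ` {1..k} \<subseteq> {1..n} \<and>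
       (\<forall>a\<in>{1..k}. \<forall>b\<in>{1..k}. p (f a) < p (f b) \<longleftrightarrow> s a < s b))"

abbreviation avoids :: "nat \<Rightarrow> (nat \<Rightarrow> nat) \<Rightarrow> nat \<Rightarrow> (nat \<Rightarrow> nat) \<Rightarrow> bool" where
  "avoids n p k s \<equiv> \<not> contains n p k s"

abbreviation avoids_4321 :: "nat \<Rightarrow> (nat \<Rightarrow> nat) \<Rightarrow> bool" where
  "avoids_4321 n p \<equiv> avoids n p 4 (one_line [4, 3, 2, 1])"

definition involution :: "nat \<Rightarrow> (nat \<Rightarrow> nat) \<Rightarrow> bool" where
  "involution n p \<longleftrightarrow> p permutes {1..n} \<and> inv p = p"

definition perm_interval :: "nat \<Rightarrow> (nat \<Rightarrow> nat) \<Rightarrow> nat set \<Rightarrow> bool" where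
  "perm_interval n p I \<longleftrightarrow>
     I \<subseteq> {1..n} \<and> (\<exists>a b. I = {a..b}) \<and> (\<exists>c d. p ` I = {c..d})"

definition simple_perm :: "nat \<Rightarrow> (nat \<Rightarrow> nat) \<Rightarrow> bool" where
  "simple_perm n p \<longleftrightarrow> p permutes {1..n} \<and>
     (\<forall>I. perm_interval n p I \<longrightarrow> I = {} \<or> (\<exists>x. I = {x}) \<or> I = {1..n})"

text \<open>
  Inflation of \<open>\<sigma>\<close>, of length \<open>k\<close>, by permutations \<open>\<alpha> i\<close> of length \<open>m i\<close>, where \<open>i \<in> {1..k}\<close>.
  Block \<open>i\<close> lies to the right of the blocks \<open>j\<close> with \<open>j < i\<close> and above the blocks \<open>j\<close> with
  \<open>\<sigma> j < \<sigma> i\<close>; the two offsets count the entries in these blocks.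
\<close>

definition pos_offset :: "(nat \<Rightarrow> nat) \<Rightarrow> nat \<Rightarrow> nat" where
  "pos_offset m i = (\<Sum>j\<in>{1..<i}. m j)"

definition val_offset :: "nat \<Rightarrow> (nat \<Rightarrow> nat) \<Rightarrow> (nat \<Rightarrow> nat) \<Rightarrow> nat \<Rightarrow> nat" where
  "val_offset k \<sigma> m i = (\<Sum>j | j \<in> {1..k} \<and> \<sigma> j < \<sigma> i. m j)"

definition block :: "(nat \<Rightarrow> nat) \<Rightarrow> nat \<Rightarrow> nat set" where
  "block m i = {pos_offset m i + 1 .. pos_offset m i + m i}"

definition inflation_length :: "nat \<Rightarrow> (nat \<Rightarrow> nat) \<Rightarrow> nat" where
  "inflation_length k m = (\<Sum>i\<in>{1..k}. m i)"

definition inflation ::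
    "nat \<Rightarrow> (nat \<Rightarrow> nat) \<Rightarrow> (nat \<Rightarrow> nat) \<Rightarrow> (nat \<Rightarrow> nat \<Rightarrow> nat) \<Rightarrow> nat \<Rightarrow> nat" where
  "inflation k \<sigma> m \<alpha> x =
     (if x \<in> {1..inflation_length k m}
      then let i = (THE i. i \<in> {1..k} \<and> x \<in> block m i)
           in val_offset k \<sigma> m i + \<alpha> i (x - pos_offset m i)
      else x)"

lemma pos_offset_mono:
  assumes "1 \<le> i" "i < j"
  shows "pos_offset m i + m i \<le> pos_offset m j"
proof -
  have "pos_offset m i + m i = (\<Sum>l\<in>insert i {1..<i}. m l)"
    by (simp add: pos_offset_def)
  also have "\<dots> \<le> pos_offset m j"
    unfolding pos_offset_def using assms by (intro sum_mono2) auto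
  finally show ?thesis .
qed

lemma pos_offset_le:
  assumes "i \<in> {1..k}"
  shows "pos_offset m i + m i \<le> inflation_length k m"
  using pos_offset_mono[of i "Suc k" m] assms
  by (simp add: pos_offset_def inflation_length_def atLeastLessThanSuc_atLeastAtMost)

lemma val_offset_mono:
  assumes "i \<in> {1..k}" "\<sigma> i < \<sigma> j"
  shows "val_offset k \<sigma> m i + m i \<le> val_offset k \<sigma> m j"
proof -
  have "val_offset k \<sigma> m i + m i = (\<Sum>l\<in>insert i {l. l \<in> {1..k} \<and> \<sigma> l < \<sigma> i}. m l)"
    by (simp add: val_offset_def)
  also have "\<dots> \<le> val_offset k \<sigma> m j"
    unfolding val_offset_def using assms by (intro sum_mono2) auto
  finally show ?thesis .
qed

lemma val_offset_le:
  assumes "i \<in> {1..k}"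
  shows "val_offset k \<sigma> m i + m i \<le> inflation_length k m"
proof -
  have "val_offset k \<sigma> m i + m i = (\<Sum>l\<in>insert i {l. l \<in> {1..k} \<and> \<sigma> l < \<sigma> i}. m l)"
    by (simp add: val_offset_def)
  also have "\<dots> \<le> inflation_length k m"
    unfolding inflation_length_def using assms by (intro sum_mono2) auto
  finally show ?thesis .
qed

lemma block_unique:
  assumes "1 \<le> i" "1 \<le> j" "x \<in> block m i" "x \<in> block m j"
  shows "i = j"
  using assms pos_offset_mono[of i j m] pos_offset_mono[of j i m]
  by (cases i j rule: linorder_cases) (auto simp: block_def)

lemma block_exists:
  assumes "x \<in> {1..inflation_length k m}"
  shows "\<exists>i\<in>{1..k}. x \<in> block m i"
  using assms
proof (induction k)
  case 0
  then show ?case by (simp add: inflation_length_def)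
next
  case (Suc k)
  have len: "inflation_length (Suc k) m = inflation_length k m + m (Suc k)"
    "pos_offset m (Suc k) = inflation_length k m"
    by (simp_all add: pos_offset_def inflation_length_def atLeastLessThanSuc_atLeastAtMost)
  show ?case
  proof (cases "x \<le> inflation_length k m")
    case True
    then show ?thesis using Suc by fastforce
  next
    case False
    then have "x \<in> block m (Suc k)" using Suc.prems len by (auto simp: block_def)
    then show ?thesis by fastforce
  qed
qed

lemma inflation_apply:
  assumes "i \<in> {1..k}" "t \<in> {1..m i}"
  shows "inflation k \<sigma> m \<alpha> (pos_offset m i + t) = val_offset k \<sigma> m i + \<alpha> i t"
proof -
  let ?x = "pos_offset m i + t"
  have blk: "?x \<in> block m i" using assms by (auto simp: block_def)
  then have the: "(THE i. i \<in> {1..k} \<and> ?x \<in> block m i) = i"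
    using assms by (intro the_equality) (auto intro: block_unique)
  have "?x \<in> {1..inflation_length k m}" using pos_offset_le[OF assms(1), of m] assms(2) by auto
  then show ?thesis unfolding inflation_def the by simp
qed

lemma inflation_permutes:
  assumes \<sigma>: "\<sigma> permutes {1..k}" and \<alpha>: "\<And>i. i \<in> {1..k} \<Longrightarrow> \<alpha> i permutes {1..m i}"
  shows "inflation k \<sigma> m \<alpha> permutes {1..inflation_length k m}"
proof -
  let ?p = "inflation k \<sigma> m \<alpha>" and ?N = "inflation_length k m"
  have dec: "\<exists>i t. i \<in> {1..k} \<and> t \<in> {1..m i} \<and> x = pos_offset m i + t \<and>
      ?p x = val_offset k \<sigma> m i + \<alpha> i t \<and> \<alpha> i t \<in> {1..m i}" if xN: "x \<in> {1..?N}" for x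
  proof -
    obtain i where i: "i \<in> {1..k}" "x \<in> block m i" using block_exists[OF xN] by blast
    define t where "t = x - pos_offset m i"
    have t: "t \<in> {1..m i}" "x = pos_offset m i + t" using i by (auto simp: block_def t_def)
    have "\<alpha> i t \<in> {1..m i}" using permutes_in_image[OF \<alpha>[OF i(1)]] t(1) by blast
    then show ?thesis using i t inflation_apply[of i k t m \<sigma> \<alpha>] by blast
  qed
  have inj: "inj_on ?p {1..?N}"
  proof (rule inj_onI)
    fix x y assume "x \<in> {1..?N}" "y \<in> {1..?N}" and eq: "?p x = ?p y"
    then obtain i t j u where it: "i \<in> {1..k}" "t \<in> {1..m i}" "x = pos_offset m i + t"
        "?p x = val_offset k \<sigma> m i + \<alpha> i t" "\<alpha> i t \<in> {1..m i}"
      and ju: "j \<in> {1..k}" "u \<in> {1..m j}" "y = pos_offset m j + u"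
        "?p y = val_offset k \<sigma> m j + \<alpha> j u" "\<alpha> j u \<in> {1..m j}"
      using dec[of x] dec[of y] by blast
    have "\<sigma> i = \<sigma> j"
      using val_offset_mono[of i k \<sigma> j m] val_offset_mono[of j k \<sigma> i m] it ju eq
      by (cases "\<sigma> i" "\<sigma> j" rule: linorder_cases) auto
    then have ij: "i = j" using permutes_inj[OF \<sigma>] by (auto dest: injD)
    then have "\<alpha> i t = \<alpha> i u" using it ju eq by simp
    then have "t = u" using permutes_inj[OF \<alpha>[OF it(1)]] by (auto dest: injD)
    then show "x = y" using ij it ju by simp
  qed
  have sub: "?p ` {1..?N} \<subseteq> {1..?N}"
  proof
    fix y assume "y \<in> ?p ` {1..?N}"
    then obtain x where x: "x \<in> {1..?N}" "y = ?p x" by blast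
    then obtain i t where "i \<in> {1..k}" "y = val_offset k \<sigma> m i + \<alpha> i t" "\<alpha> i t \<in> {1..m i}"
      using dec[OF x(1)] by metis
    then show "y \<in> {1..?N}" using val_offset_le[of i k \<sigma> m] by auto
  qed
  have "bij_betw ?p {1..?N} {1..?N}"
    using inj sub by (simp add: bij_betw_def endo_inj_surj)
  then show ?thesis by (rule bij_imp_permutes) (simp only: inflation_def if_False)
qed

end

theory Submission imports Defs begin

text \<open>
  Let \<open>\<pi>\<close> be the inflation, with position blocks \<open>B\<^sub>i\<close> and value blocks \<open>V\<^sub>i = \<pi>(B\<^sub>i)\<close>. Since \<open>\<pi>\<close> is an
  involution, \<open>B\<^sub>l\<close> meets \<open>V\<^sub>i\<close> iff \<open>V\<^sub>l\<close> meets \<open>B\<^sub>i\<close>; hence for fixed \<open>i\<close> the set of these \<open>l\<close> is an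
  interval of \<open>\<sigma>\<close>. It cannot be all of \<open>{1..k}\<close>: otherwise \<open>V\<^sub>i\<close> contains \<open>B\<^sub>l\<close> both when \<open>l\<close> is not an
  extreme position and when \<open>\<sigma> l\<close> is not an extreme value;
  by simplicity these cases cover every \<open>l\<close>, leaving no room for other value blocks. So
  each \<open>V\<^sub>i\<close> lies in a single position block; the induced map on indices is an involution
  ordering the blocks as \<open>\<sigma>\<close> does, whence \<open>V\<^sub>i = B\<^sub>\<sigma>\<^sub>i\<close> and \<open>\<alpha> (\<sigma> i)\<close> is inverse to \<open>\<alpha> i\<close>.
  An inversion in \<open>\<alpha> i\<close> then extends to the pattern 4321: if \<open>\<sigma> i \<noteq> i\<close>, with an inversion in \<open>\<alpha> (\<sigma> i)\<close>;
  if \<open>\<sigma> i = i\<close>, with the two entries of a transposition \<open>(a b)\<close> of \<open>\<sigma>\<close> such that \<open>a < i < b\<close>, which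
  exists because \<open>{1..i}\<close> is not an interval of \<open>\<sigma>\<close>.
\<close>

section \<open>The pattern 4321, increasing maps and integer intervals\<close>

lemma contains_4321I:
  assumes "x1 < x2" "x2 < x3" "x3 < x4" "1 \<le> x1" "x4 \<le> n"
    and "p x1 > p x2" "p x2 > p x3" "p x3 > (p x4 :: nat)"
  shows "contains n p 4 (one_line [4, 3, 2, 1])"
proof -
  define f where "f = one_line [x1, x2, x3, x4]"
  have eq: "{1..4::nat} = {1, 2, 3, 4}" by auto
  have f: "f 1 = x1" "f 2 = x2" "f 3 = x3" "f 4 = x4"
    by (simp_all add: f_def one_line_def numeral_eq_Suc)
  have g: "one_line [4, 3, 2, 1] 1 = 4" "one_line [4, 3, 2, 1] 2 = 3"
    "one_line [4, 3, 2, 1] 3 = 2" "one_line [4, 3, 2, 1] 4 = 1"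
    by (simp_all add: one_line_def numeral_eq_Suc)
  have "strict_mono_on {1..4} f"
    unfolding eq strict_mono_on_def using assms f by auto
  moreover have "f ` {1..4} \<subseteq> {1..n}" unfolding eq using assms f by auto
  moreover have "\<forall>a\<in>{1..4}. \<forall>b\<in>{1..4}. p (f a) < p (f b) \<longleftrightarrow>
      one_line [4, 3, 2, 1] a < one_line [4, 3, 2, 1] b"
    unfolding eq using assms f g by auto
  ultimately show ?thesis unfolding contains_def by blast
qed

text \<open>Upward induction from 1 gives \<open>y \<le> f y\<close>, and downward induction from
  \<open>n\<close> gives \<open>f y \<le> y\<close>.\<close>

lemma strict_mono_on_interval_id:
  fixes f :: "nat \<Rightarrow> nat"
  assumes mono: "strict_mono_on {1..n} f" and im: "f ` {1..n} \<subseteq> {1..n}" and x: "x \<in> {1..n}"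
  shows "f x = x"
proof -
  have less: "f y < f (Suc y)" if "1 \<le> y" "Suc y \<le> n" for y
    using mono that by (simp add: strict_mono_on_def)
  have ge: "y \<le> n \<longrightarrow> y \<le> f y" if "1 \<le> y" for y
    using that
  proof (induction y rule: dec_induct)
    case base
    then show ?case using im by force
  next
    case (step y)
    then show ?case using less[of y] by auto
  qed
  have le: "1 \<le> y \<longrightarrow> f y \<le> y" if "y \<le> n" for y
    using that
  proof (induction y rule: inc_induct)
    case base
    then show ?case using im by force
  next
    case (step y)
    then show ?case using less[of y] by auto
  qed
  show ?thesis using ge[of x] le[of x] x by auto
qed

lemma permutes_no_inversion_id:
  fixes p :: "nat \<Rightarrow> nat"
  assumes p: "p permutes {1..n}"
    and no_inversion: "\<And>s t. s \<in> {1..n} \<Longrightarrow> t \<in> {1..n} \<Longrightarrow> s < t \<Longrightarrow> \<not> p t < p s"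
  shows "p = id"
proof
  fix x
  have "strict_mono_on {1..n} p"
  proof (rule strict_mono_onI)
    fix s t assume "s \<in> {1..n}" "t \<in> {1..n}" "s < t"
    moreover have "p s \<noteq> p t" using permutes_inj[OF p] \<open>s < t\<close> by (auto dest: injD)
    ultimately show "p s < p t" using no_inversion[of s t] by linarith
  qed
  then show "p x = id x"
    using strict_mono_on_interval_id[of n p x] permutes_image[OF p] permutes_not_in[OF p]
    by (cases "x \<in> {1..n}") auto
qed

lemma nat_set_atLeastAtMostI:
  fixes S :: "nat set"
  assumes "finite S" "\<And>x y z. x \<in> S \<Longrightarrow> z \<in> S \<Longrightarrow> x < y \<Longrightarrow> y < z \<Longrightarrow> y \<in> S"
  shows "\<exists>a b. S = {a..b}"
proof (cases "S = {}")
  case True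
  then have "S = {1..0}" by simp
  then show ?thesis by blast
next
  case False
  have "y \<in> S" if "Min S \<le> y" "y \<le> Max S" for y
    using assms(2)[of "Min S" "Max S" y] Min_in[OF assms(1) False] Max_in[OF assms(1) False] that
    by (cases "y = Min S \<or> y = Max S") auto
  then have "S = {Min S..Max S}"
    using Min_le[OF assms(1)] Max_ge[OF assms(1)] by (blast intro: atLeastAtMost_iff[THEN iffD2]
        dest: atLeastAtMost_iff[THEN iffD1])
  then show ?thesis by blast
qed

lemma involution_apply: "involution n p \<Longrightarrow> p (p x) = x"
  unfolding involution_def by (metis permutes_inverses(1))

section \<open>Simple permutations: extreme entries and fixed points\<close>

lemma simple_perm_interval:
  assumes "simple_perm k \<sigma>" "perm_interval k \<sigma> I"
  shows "card I \<le> 1 \<or> I = {1..k}"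
proof -
  have "I = {} \<or> (\<exists>x. I = {x}) \<or> I = {1..k}" using assms unfolding simple_perm_def by blast
  then show ?thesis by auto
qed

lemma simple_perm_prefix:
  assumes "simple_perm k \<sigma>" "1 < i" "i < k"
  shows "\<sigma> ` {1..i} \<noteq> {1..i}"
proof
  assume "\<sigma> ` {1..i} = {1..i}"
  then have "perm_interval k \<sigma> {1..i}" using assms by (auto simp: perm_interval_def)
  then have "card {1..i} \<le> 1 \<or> {1..i} = {1..k}" by (rule simple_perm_interval[OF assms(1)])
  then show False using assms(2,3) by (auto simp: Icc_eq_Icc)
qed

text \<open>If an extreme position carried an extreme value, deleting that entry would leave a
  proper interval with \<open>k - 1 \<ge> 2\<close> elements.\<close>

lemma simple_perm_end:
  assumes "simple_perm k \<sigma>" "k \<ge> 3" "e = 1 \<or> e = k"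
  shows "\<sigma> e \<noteq> 1" "\<sigma> e \<noteq> k"
proof -
  have \<sigma>: "\<sigma> permutes {1..k}" using assms(1) by (simp add: simple_perm_def)
  have del: "\<exists>a b. {1..k} - {x} = {a..b}" if "x = 1 \<or> x = k" for x
  proof -
    have "{1..k} - {1} = {2..k}" "{1..k} - {k} = {1..k-1}" by auto
    then show ?thesis using that by metis
  qed
  have "\<not> (\<sigma> e = 1 \<or> \<sigma> e = k)"
  proof
    assume "\<sigma> e = 1 \<or> \<sigma> e = k"
    moreover have "\<sigma> ` ({1..k} - {e}) = {1..k} - {\<sigma> e}"
      using permutes_image[OF \<sigma>] permutes_inj[OF \<sigma>] by (simp add: image_set_diff)
    ultimately have "perm_interval k \<sigma> ({1..k} - {e})"
      using del[of e] del[of "\<sigma> e"] assms(3) by (auto simp: perm_interval_def)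
    then have "card ({1..k} - {e}) \<le> 1 \<or> {1..k} - {e} = {1..k}"
      by (rule simple_perm_interval[OF assms(1)])
    moreover have "e \<in> {1..k}" using assms(2,3) by auto
    moreover from this have "card ({1..k} - {e}) = k - 1" by simp
    ultimately show False using assms(2) by (elim disjE) (linarith, blast)
  qed
  then show "\<sigma> e \<noteq> 1" "\<sigma> e \<noteq> k" by auto
qed

lemma simple_involution_fixed_point:
  assumes simple: "simple_perm k \<sigma>" and inv: "involution k \<sigma>" and "k \<ge> 3"
    and i: "i \<in> {1..k}" "\<sigma> i = i"
  obtains a where "a \<in> {1..k}" "a < i" "i < \<sigma> a"
proof -
  have "i \<noteq> 1" "i \<noteq> k" using simple_perm_end[OF simple \<open>k \<ge> 3\<close>, of i] i by auto
  then have "1 < i" "i < k" using i by auto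
  note ne = simple_perm_prefix[OF simple this]
  have \<sigma>: "\<sigma> permutes {1..k}" using simple by (simp add: simple_perm_def)
  \<comment> \<open>On a finite set an injective self-map is onto, so inclusion would already give
    the excluded equality.\<close>
  have "\<not> \<sigma> ` {1..i} \<subseteq> {1..i}"
    using ne endo_inj_surj[of "{1..i}" \<sigma>] permutes_inj_on[OF \<sigma>] by auto
  then obtain a where a: "a \<in> {1..i}" "\<sigma> a \<notin> {1..i}" by blast
  have "\<sigma> a \<in> {1..k}" using permutes_in_image[OF \<sigma>, of a] a(1) i by auto
  then have "i < \<sigma> a" using a by auto
  moreover have "a < i" using a i by (cases "a = i") auto
  ultimately show ?thesis using that[of a] a i by auto
qed

section \<open>Position blocks and value blocks of an inflation\<close>

definition value_block :: "nat \<Rightarrow> (nat \<Rightarrow> nat) \<Rightarrow> (nat \<Rightarrow> nat) \<Rightarrow> nat \<Rightarrow> nat set" where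
  "value_block k \<sigma> m i = {val_offset k \<sigma> m i + 1 .. val_offset k \<sigma> m i + m i}"

lemma block_less:
  assumes "1 \<le> i" "i < j" "x \<in> block m i" "y \<in> block m j"
  shows "x < y"
  using assms pos_offset_mono[of i j m] by (auto simp: block_def)

lemma value_block_less:
  assumes "i \<in> {1..k}" "\<sigma> i < \<sigma> j" "x \<in> value_block k \<sigma> m i" "y \<in> value_block k \<sigma> m j"
  shows "x < y"
  using assms val_offset_mono[of i k \<sigma> j m] by (auto simp: value_block_def)

lemma inflation_image_block:
  assumes i: "i \<in> {1..k}" and \<alpha>: "\<alpha> i permutes {1..m i}"
  shows "inflation k \<sigma> m \<alpha> ` block m i = value_block k \<sigma> m i"
proof -
  have shift: "{a + 1..a + b} = (+) a ` {1..b}" for a b :: nat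
    by (simp add: image_add_atLeastAtMost)
  have "inflation k \<sigma> m \<alpha> ` block m i = (\<lambda>t. inflation k \<sigma> m \<alpha> (pos_offset m i + t)) ` {1..m i}"
    by (simp only: block_def shift image_image)
  also have "\<dots> = (\<lambda>t. val_offset k \<sigma> m i + \<alpha> i t) ` {1..m i}"
    using inflation_apply[OF i] by (intro image_cong) auto
  also have "\<dots> = (+) (val_offset k \<sigma> m i) ` \<alpha> i ` {1..m i}" by (simp only: image_image)
  also have "\<dots> = value_block k \<sigma> m i"
    by (simp only: permutes_image[OF \<alpha>] value_block_def shift)
  finally show ?thesis .
qed

section \<open>Block structure of an inflation that is an involution\<close>

locale simple_inflation =
  fixes k :: nat and \<sigma> m :: "nat \<Rightarrow> nat" and \<alpha> :: "nat \<Rightarrow> nat \<Rightarrow> nat"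
  assumes k: "k \<ge> 3"
    and simple: "simple_perm k \<sigma>"
    and inv\<sigma>: "involution k \<sigma>"
    and pos: "\<And>i. i \<in> {1..k} \<Longrightarrow> m i \<ge> 1"
    and \<alpha>: "\<And>i. i \<in> {1..k} \<Longrightarrow> \<alpha> i permutes {1..m i}"
    and inv\<pi>: "involution (inflation_length k m) (inflation k \<sigma> m \<alpha>)"
begin

abbreviation "\<pi> \<equiv> inflation k \<sigma> m \<alpha>"
abbreviation "B \<equiv> block m"
abbreviation "V \<equiv> value_block k \<sigma> m"

text \<open>Simplicity will force this set to be a singleton, and \<open>V_eq_B\<close> identifies
  its element as \<open>\<sigma> i\<close>.\<close>

definition meet :: "nat \<Rightarrow> nat set" where
  "meet i = {l \<in> {1..k}. B l \<inter> V i \<noteq> {}}"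

lemma \<sigma>_permutes: "\<sigma> permutes {1..k}"
  using simple by (simp add: simple_perm_def)

lemma \<sigma>_in: "i \<in> {1..k} \<Longrightarrow> \<sigma> i \<in> {1..k}"
  using permutes_in_image[OF \<sigma>_permutes] by blast

lemma \<sigma>\<sigma>: "\<sigma> (\<sigma> i) = i"
  using involution_apply[OF inv\<sigma>] .

lemma \<pi>\<pi>: "\<pi> (\<pi> x) = x"
  using involution_apply[OF inv\<pi>] .

lemma \<pi>_B: "i \<in> {1..k} \<Longrightarrow> \<pi> ` B i = V i"
  using inflation_image_block \<alpha> by blast

lemma \<pi>_V: "i \<in> {1..k} \<Longrightarrow> \<pi> ` V i = B i"
  by (simp add: \<pi>_B[symmetric] image_image \<pi>\<pi>)

lemma \<pi>_in_V: "i \<in> {1..k} \<Longrightarrow> x \<in> B i \<Longrightarrow> \<pi> x \<in> V i"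
  using \<pi>_B by blast

lemma \<pi>_in_B: "i \<in> {1..k} \<Longrightarrow> x \<in> V i \<Longrightarrow> \<pi> x \<in> B i"
  using \<pi>_V by blast

lemma B_nonempty: "i \<in> {1..k} \<Longrightarrow> B i \<noteq> {}"
  using pos[of i] by (simp add: block_def)

lemma V_nonempty: "i \<in> {1..k} \<Longrightarrow> V i \<noteq> {}"
  using pos[of i] by (simp add: value_block_def)

lemma B_subset: "i \<in> {1..k} \<Longrightarrow> B i \<subseteq> {1..inflation_length k m}"
  using pos_offset_le[of i k m] by (auto simp: block_def)

lemma V_subset: "i \<in> {1..k} \<Longrightarrow> V i \<subseteq> {1..inflation_length k m}"
  using val_offset_le[of i k \<sigma> m] by (auto simp: value_block_def)

text \<open>The involution \<open>\<pi>\<close> exchanges \<open>B l \<inter> V i\<close> with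
  \<open>V l \<inter> B i\<close>.\<close>

lemma meet_sym:
  assumes "i \<in> {1..k}" "l \<in> {1..k}"
  shows "l \<in> meet i \<longleftrightarrow> i \<in> meet l"
  using assms \<pi>_in_V \<pi>_in_B unfolding meet_def by blast

text \<open>\<open>V i\<close> is an integer interval with points on both sides of
  \<open>B l'\<close>. Full inclusion, rather than mere intersection, is what
  \<open>meet_not_full\<close> exploits.\<close>

lemma B_between:
  assumes "l \<in> meet i" "l'' \<in> meet i" "l < l'" "l' < l''"
  shows "B l' \<subseteq> V i"
proof
  fix y assume y: "y \<in> B l'"
  obtain x z where "x \<in> B l" "x \<in> V i" "z \<in> B l''" "z \<in> V i" "1 \<le> l"
    using assms by (auto simp: meet_def)
  moreover have "x < y" "y < z"
    using block_less[of l l' x m y] block_less[of l' l'' y m z] calculation assms y by auto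
  ultimately show "y \<in> V i" by (auto simp: value_block_def)
qed

text \<open>The counterpart of \<open>B_between\<close> for the order of values: by
  \<open>meet_sym\<close>, \<open>B i\<close> meets \<open>V l\<close> and \<open>V l''\<close>, so
  it contains \<open>V l'\<close>; applying \<open>\<pi>\<close> turns this into the claim.\<close>

lemma V_between:
  assumes i: "i \<in> {1..k}" and l: "l \<in> meet i" "l'' \<in> meet i" "l' \<in> {1..k}"
    and less: "\<sigma> l < \<sigma> l'" "\<sigma> l' < \<sigma> l''"
  shows "B l' \<subseteq> V i"
proof -
  have lk: "l \<in> {1..k}" "l'' \<in> {1..k}" using l by (auto simp: meet_def)
  have "V l' \<subseteq> B i"
  proof
    fix y assume y: "y \<in> V l'"
    obtain x z where xz: "x \<in> V l" "x \<in> B i" "z \<in> V l''" "z \<in> B i"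
      using meet_sym[OF i lk(1)] meet_sym[OF i lk(2)] l unfolding meet_def by blast
    have "x < y" "y < z"
      using value_block_less[OF lk(1) less(1) xz(1) y] value_block_less[OF l(3) less(2) y xz(3)] .
    then show "y \<in> B i" using xz by (auto simp: block_def)
  qed
  then show ?thesis using \<pi>_V[OF l(3)] \<pi>_B[OF i] by blast
qed

lemma meet_nonempty:
  assumes i: "i \<in> {1..k}"
  shows "meet i \<noteq> {}"
proof -
  obtain x where x: "x \<in> V i" using V_nonempty[OF i] by blast
  then obtain l where "l \<in> {1..k}" "x \<in> B l"
    using V_subset[OF i] block_exists[of x k m] by blast
  then show ?thesis using x by (auto simp: meet_def)
qed

lemma meet_interval:
  assumes i: "i \<in> {1..k}"
  shows "perm_interval k \<sigma> (meet i)"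
proof -
  have sub: "meet i \<subseteq> {1..k}" by (auto simp: meet_def)
  then have fin: "finite (meet i)" using finite_subset by blast
  have "\<exists>a b. meet i = {a..b}"
  proof (rule nat_set_atLeastAtMostI[OF fin])
    fix x y z assume *: "x \<in> meet i" "z \<in> meet i" "x < y" "y < z"
    then have "y \<in> {1..k}" using sub by auto
    then show "y \<in> meet i" using B_between[OF *] B_nonempty[of y] by (auto simp: meet_def)
  qed
  moreover have "\<exists>a b. \<sigma> ` meet i = {a..b}"
  proof (rule nat_set_atLeastAtMostI)
    fix x y z assume *: "x \<in> \<sigma> ` meet i" "z \<in> \<sigma> ` meet i" "x < y" "y < z"
    then obtain l l'' where l: "l \<in> meet i" "x = \<sigma> l" "l'' \<in> meet i" "z = \<sigma> l''" by blast
    have "x \<in> {1..k}" "z \<in> {1..k}" using l sub \<sigma>_in by blast+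
    \<comment> \<open>As \<open>\<sigma>\<close> is an involution, the position carrying the value
      \<open>y\<close> is \<open>\<sigma> y\<close>.\<close>
    then have "\<sigma> y \<in> {1..k}" using * \<sigma>_in by auto
    then have "\<sigma> y \<in> meet i"
      using V_between[OF i l(1,3), of "\<sigma> y"] B_nonempty[of "\<sigma> y"] * l
      by (auto simp: meet_def \<sigma>\<sigma>)
    then show "y \<in> \<sigma> ` meet i" using \<sigma>\<sigma>[of y] by (metis imageI)
  qed (use fin in simp)
  ultimately show ?thesis using sub by (simp add: perm_interval_def)
qed

lemma meet_not_full:
  assumes i: "i \<in> {1..k}"
  shows "meet i \<noteq> {1..k}"
proof
  assume full: "meet i = {1..k}"
  have all: "B l \<subseteq> V i" if l: "l \<in> {1..k}" for l
  proof (cases "l = 1 \<or> l = k")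
    case True
    \<comment> \<open>An extreme position carries a non-extreme value, so \<open>V l\<close> lies
      between the value blocks of \<open>\<sigma> 1\<close> and \<open>\<sigma> k\<close>, whose
      values under \<open>\<sigma>\<close> are 1 and \<open>k\<close>.\<close>
    then have "\<sigma> l \<noteq> 1" "\<sigma> l \<noteq> k" using simple_perm_end[OF simple k] by auto
    then have "1 < \<sigma> l" "\<sigma> l < k" using \<sigma>_in[OF l] by auto
    moreover have "\<sigma> 1 \<in> meet i" "\<sigma> k \<in> meet i" using full \<sigma>_in k by auto
    ultimately show ?thesis using V_between[OF i, of "\<sigma> 1" "\<sigma> k" l] l by (simp add: \<sigma>\<sigma>)
  next
    case False
    then show ?thesis using B_between[of 1 i k l] full l k by auto
  qed
  \<comment> \<open>\<open>V i\<close> now contains every position block, hence also a point of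
    \<open>V l\<close> for a second index \<open>l\<close>. Disjointness is known for position
    blocks, so \<open>\<pi>\<close> carries this point there.\<close>
  obtain l where l: "l \<in> {1..k}" "l \<noteq> i"
    using k by (cases "i = 1") (auto intro: that[of 1] that[of 2])
  obtain x where x: "x \<in> V l" using V_nonempty[OF l(1)] by blast
  obtain j where "j \<in> {1..k}" "x \<in> B j"
    using x V_subset[OF l(1)] block_exists[of x k m] by blast
  then have "x \<in> V i" using all by blast
  then have "\<pi> x \<in> B i" "\<pi> x \<in> B l" using x \<pi>_in_B i l by blast+
  then show False using block_unique[of i l "\<pi> x" m] i l by auto
qed

lemma meet_singleton:
  assumes "i \<in> {1..k}"
  shows "\<exists>l. meet i = {l}"
  using meet_interval[OF assms] meet_nonempty[OF assms] meet_not_full[OF assms] simple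
  unfolding simple_perm_def by blast

lemma V_eq_B:
  assumes i: "i \<in> {1..k}"
  shows "V i = B (\<sigma> i)"
proof -
  \<comment> \<open>\<open>g i\<close> is the index of the only position block that
    \<open>V i\<close> meets; the goal is \<open>g = \<sigma>\<close> on
    \<open>{1..k}\<close>.\<close>
  define g where "g i = (THE l. meet i = {l})" for i
  have meet_g: "meet i = {g i}" if i: "i \<in> {1..k}" for i
    using meet_singleton[OF i] by (auto simp: g_def)
  have g_in: "g i \<in> {1..k}" if i: "i \<in> {1..k}" for i
    using meet_g[OF i] by (auto simp: meet_def)
  have gg: "g (g i) = i" if i: "i \<in> {1..k}" for i
    using meet_sym[OF i g_in[OF i]] meet_g[OF i] meet_g[OF g_in[OF i]] by simp
  have sub: "V i \<subseteq> B (g i)" if i: "i \<in> {1..k}" for i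
  proof
    fix x assume x: "x \<in> V i"
    then obtain l where l: "l \<in> {1..k}" "x \<in> B l"
      using V_subset[OF i] block_exists[of x k m] by blast
    then have "l \<in> meet i" using x by (auto simp: meet_def)
    then show "x \<in> B (g i)" using meet_g[OF i] l by simp
  qed
  have g_eq: "V i = B (g i)" if i: "i \<in> {1..k}" for i
  proof -
    \<comment> \<open>Used at \<open>i\<close> and at \<open>g i\<close>, this gives
      \<open>m i \<le> m (g i) \<le> m i\<close>, so the inclusion
      \<open>V i \<subseteq> B (g i)\<close> is an equality.\<close>
    have "card (V l) \<le> card (B (g l))" if "l \<in> {1..k}" for l
      using sub[OF that] by (intro card_mono) (auto simp: block_def)
    from this[OF i] this[OF g_in[OF i]] have "card (V i) = card (B (g i))"
      using gg[OF i] by (simp add: value_block_def block_def)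
    then show ?thesis using sub[OF i] by (intro card_subset_eq) (auto simp: block_def)
  qed
  \<comment> \<open>Listed from bottom to top, the value blocks have indices
    \<open>\<sigma> 1, ..., \<sigma> k\<close>. Being the position blocks
    \<open>B (g (\<sigma> j))\<close>, they also run from left to right, so \<open>g\<close> after
    \<open>\<sigma>\<close> is increasing and hence the identity.\<close>
  have "strict_mono_on {1..k} (\<lambda>j. g (\<sigma> j))"
  proof (rule strict_mono_onI)
    fix a b assume ab: "a \<in> {1..k}" "b \<in> {1..k}" "a < b"
    obtain x y where xy: "x \<in> V (\<sigma> a)" "y \<in> V (\<sigma> b)" 
      using V_nonempty[OF \<sigma>_in[OF ab(1)]] V_nonempty[OF \<sigma>_in[OF ab(2)]] by blast
    have "x < y" using value_block_less[of "\<sigma> a" k \<sigma> "\<sigma> b" x m y] xy ab \<sigma>_in[OF ab(1)]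
      by (simp add: \<sigma>\<sigma>)
    have "x \<in> B (g (\<sigma> a))" "y \<in> B (g (\<sigma> b))"
      using xy g_eq[OF \<sigma>_in[OF ab(1)]] g_eq[OF \<sigma>_in[OF ab(2)]] by simp_all
    then have "\<not> g (\<sigma> b) < g (\<sigma> a)"
      using block_less[of "g (\<sigma> b)" "g (\<sigma> a)" y m x] g_in[OF \<sigma>_in[OF ab(2)]] \<open>x < y\<close> by auto
    moreover have "g (\<sigma> a) \<noteq> g (\<sigma> b)"
      using gg[OF \<sigma>_in[OF ab(1)]] gg[OF \<sigma>_in[OF ab(2)]] \<sigma>\<sigma> ab(3) by (metis less_irrefl)
    ultimately show "g (\<sigma> a) < g (\<sigma> b)" by linarith
  qed
  then have "g (\<sigma> (\<sigma> i)) = \<sigma> i"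
    by (rule strict_mono_on_interval_id) (use \<sigma>_in[OF i] g_in \<sigma>_in in blast)+
  then show ?thesis using g_eq[OF i] by (simp add: \<sigma>\<sigma>)
qed

lemma length_\<sigma>:
  assumes i: "i \<in> {1..k}"
  shows "m (\<sigma> i) = m i"
  using V_eq_B[OF i] pos[OF i] unfolding value_block_def block_def Icc_eq_Icc by auto

lemma val_offset_eq:
  assumes i: "i \<in> {1..k}"
  shows "val_offset k \<sigma> m i = pos_offset m (\<sigma> i)"
  using V_eq_B[OF i] pos[OF i] unfolding value_block_def block_def Icc_eq_Icc by auto

section \<open>Inversions inside blocks\<close>

lemma \<alpha>_in: "i \<in> {1..k} \<Longrightarrow> t \<in> {1..m i} \<Longrightarrow> \<alpha> i t \<in> {1..m i}"
  using permutes_in_image[OF \<alpha>] by blast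

text \<open>Inside block \<open>i\<close>, applying \<open>\<pi>\<close> twice passes through block
  \<open>\<sigma> i\<close> and back, with matching offsets. Outside \<open>{1..m i}\<close> both
  factors are the identity because the lengths agree.\<close>

lemma \<alpha>_\<sigma>_\<alpha>:
  assumes i: "i \<in> {1..k}"
  shows "\<alpha> (\<sigma> i) (\<alpha> i t) = t"
proof (cases "t \<in> {1..m i}")
  case True
  have "\<alpha> i t \<in> {1..m (\<sigma> i)}" using \<alpha>_in[OF i True] length_\<sigma>[OF i] by simp
  then have "\<pi> (\<pi> (pos_offset m i + t)) = pos_offset m i + \<alpha> (\<sigma> i) (\<alpha> i t)"
    using inflation_apply[of i k t m \<sigma> \<alpha>] inflation_apply[of "\<sigma> i" k "\<alpha> i t" m \<sigma> \<alpha>] i True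
      \<sigma>_in[OF i] val_offset_eq[OF i] val_offset_eq[OF \<sigma>_in[OF i]]
    by (simp add: \<sigma>\<sigma>)
  then show ?thesis by (simp add: \<pi>\<pi>)
next
  case False
  then show ?thesis
    using permutes_not_in[OF \<alpha>[OF i]] permutes_not_in[OF \<alpha>[OF \<sigma>_in[OF i]]] length_\<sigma>[OF i] by metis
qed

text \<open>Inverting a permutation exchanges positions and values, so an inversion at
  \<open>s\<close>, \<open>t\<close> becomes one at \<open>\<alpha> i t\<close>,
  \<open>\<alpha> i s\<close>.\<close>

lemma inversion_\<sigma>:
  assumes i: "i \<in> {1..k}" and st: "s \<in> {1..m i}" "t \<in> {1..m i}" "s < t" "\<alpha> i t < \<alpha> i s"
  obtains s' t' where "s' \<in> {1..m (\<sigma> i)}" "t' \<in> {1..m (\<sigma> i)}" "s' < t'" "\<alpha> (\<sigma> i) t' < \<alpha> (\<sigma> i) s'"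
proof (rule that)
  show "\<alpha> i t \<in> {1..m (\<sigma> i)}" "\<alpha> i s \<in> {1..m (\<sigma> i)}" "\<alpha> i t < \<alpha> i s"
    using \<alpha>_in[OF i] st length_\<sigma>[OF i] by simp_all
  show "\<alpha> (\<sigma> i) (\<alpha> i s) < \<alpha> (\<sigma> i) (\<alpha> i t)" using st by (simp add: \<alpha>_\<sigma>_\<alpha>[OF i])
qed

lemma inversion_in_block:
  assumes i: "i \<in> {1..k}" and st: "s \<in> {1..m i}" "t \<in> {1..m i}" "s < t" "\<alpha> i t < \<alpha> i s"
  obtains x y where "x \<in> B i" "y \<in> B i" "x < y" "\<pi> y < \<pi> x"
  using that[of "pos_offset m i + s" "pos_offset m i + t"] st
  by (auto simp: block_def inflation_apply[OF i])

lemma \<alpha>_id: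
  assumes i: "i \<in> {1..k}" and avoid: "avoids_4321 (inflation_length k m) \<pi>"
  shows "\<alpha> i = id"
proof (rule permutes_no_inversion_id[OF \<alpha>[OF i]])
  fix s t assume st: "s \<in> {1..m i}" "t \<in> {1..m i}" "s < t"
  show "\<not> \<alpha> i t < \<alpha> i s"
  proof
    assume inversion: "\<alpha> i t < \<alpha> i s"
    obtain x y where xy: "x \<in> B i" "y \<in> B i" "x < y" "\<pi> y < \<pi> x"
      using inversion_in_block[OF i st inversion] .
    have \<pi>_less: "\<pi> v < \<pi> u" if "u \<in> B a" "v \<in> B b" "a \<in> {1..k}" "b \<in> {1..k}" "\<sigma> b < \<sigma> a" for a b u v
      using value_block_less[OF that(4,5) \<pi>_in_V[OF that(4,2)] \<pi>_in_V[OF that(3,1)]] .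
    have "\<exists>x1 x2 x3 x4. x1 \<in> {1..inflation_length k m} \<and> x4 \<in> {1..inflation_length k m} \<and>
      x1 < x2 \<and> x2 < x3 \<and> x3 < x4 \<and> \<pi> x1 > \<pi> x2 \<and> \<pi> x2 > \<pi> x3 \<and> \<pi> x3 > \<pi> x4"
    proof (cases "\<sigma> i = i")
      case True
      obtain a where a: "a \<in> {1..k}" "a < i" "i < \<sigma> a"
        using simple_involution_fixed_point[OF simple inv\<sigma> k i True] .
      \<comment> \<open>The pattern is read at \<open>w\<close>, \<open>x\<close>, \<open>y\<close>,
        \<open>z\<close>: block \<open>a\<close> lies to the left of and above block
        \<open>i\<close>, and block \<open>\<sigma> a\<close> to the right of and below it.\<close>
      obtain w z where wz: "w \<in> B a" "z \<in> B (\<sigma> a)" using B_nonempty a \<sigma>_in by blast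
      have "w < x" "y < z"
        using block_less[of a i w m x] block_less[of i "\<sigma> a" y m z] wz xy a i by auto
      moreover have "\<pi> x < \<pi> w" "\<pi> z < \<pi> y"
        using \<pi>_less[of w a x i] \<pi>_less[of y i z "\<sigma> a"] wz xy a i True \<sigma>_in[OF a(1)] \<sigma>\<sigma> by auto
      moreover have "w \<in> {1..inflation_length k m}" "z \<in> {1..inflation_length k m}"
        using wz B_subset a \<sigma>_in by blast+
      ultimately show ?thesis using xy by blast
    next
      case False
      obtain s' t' where st': "s' \<in> {1..m (\<sigma> i)}" "t' \<in> {1..m (\<sigma> i)}" "s' < t'"
          "\<alpha> (\<sigma> i) t' < \<alpha> (\<sigma> i) s'"
        using inversion_\<sigma>[OF i st inversion] .
      obtain x' y' where xy': "x' \<in> B (\<sigma> i)" "y' \<in> B (\<sigma> i)" "x' < y'" "\<pi> y' < \<pi> x'"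
        using inversion_in_block[OF \<sigma>_in[OF i] st'] .
      note in_range = subsetD[OF B_subset[OF i] xy(1)] subsetD[OF B_subset[OF i] xy(2)]
        subsetD[OF B_subset[OF \<sigma>_in[OF i]] xy'(1)] subsetD[OF B_subset[OF \<sigma>_in[OF i]] xy'(2)]
      show ?thesis
      \<comment> \<open>Of the two blocks of a transposition, the left one lies above the right one,
        so its descending pair comes first in the pattern.\<close>
      proof (cases "i < \<sigma> i")
        case True
        then have "y < x'" "\<pi> x' < \<pi> y"
          using block_less[of i "\<sigma> i" y m x'] \<pi>_less[of y i x' "\<sigma> i"] xy xy' i \<sigma>_in[OF i] \<sigma>\<sigma> by auto
        then show ?thesis using xy xy' in_range by blast
      next
        case gt: False
        then have "y' < x" "\<pi> x < \<pi> y'"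
          using block_less[of "\<sigma> i" i y' m x] \<pi>_less[of y' "\<sigma> i" x i] xy xy' i False \<sigma>_in[OF i] \<sigma>\<sigma>
          by auto
        then show ?thesis using xy xy' in_range by blast
      qed
    qed
    then show False using avoid contains_4321I[where p = \<pi>] by (metis atLeastAtMost_iff)
  qed
qed

end

text \<open>Lets the constant family \<open>id\<close> replace \<open>\<alpha>\<close>, whose
  members are only constrained for indices in \<open>{1..k}\<close>.\<close>

lemma inflation_cong:
  assumes "\<And>i. i \<in> {1..k} \<Longrightarrow> \<alpha> i = \<beta> i"
  shows "inflation k \<sigma> m \<alpha> = inflation k \<sigma> m \<beta>"
proof
  fix x
  show "inflation k \<sigma> m \<alpha> x = inflation k \<sigma> m \<beta> x"
  proof (cases "x \<in> {1..inflation_length k m}")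
    case True
    then obtain i where i: "i \<in> {1..k}" "x \<in> block m i" using block_exists by blast
    then have "x = pos_offset m i + (x - pos_offset m i)" "x - pos_offset m i \<in> {1..m i}"
      by (auto simp: block_def)
    then show ?thesis using inflation_apply[OF i(1)] assms[OF i(1)] by metis
  next
    case False
    then show ?thesis unfolding inflation_def by (simp only: if_False)
  qed
qed

theorem theorem3p2:
  fixes k :: nat and \<sigma> :: "nat \<Rightarrow> nat" and m :: "nat \<Rightarrow> nat" and \<alpha> :: "nat \<Rightarrow> nat \<Rightarrow> nat"
  assumes "k \<ge> 3"
    and "simple_perm k \<sigma>" and "involution k \<sigma>" and "avoids_4321 k \<sigma>"
    and "\<And>i. i \<in> {1..k} \<Longrightarrow> m i \<ge> 1"
    and "\<And>i. i \<in> {1..k} \<Longrightarrow> \<alpha> i permutes {1..m i}"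
    and "involution (inflation_length k m) (inflation k \<sigma> m \<alpha>)"
    and "avoids_4321 (inflation_length k m) (inflation k \<sigma> m \<alpha>)"
  shows "(\<forall>i\<in>{1..k}. \<sigma> i = i \<longrightarrow> \<alpha> i = id) \<and>
    (\<forall>i\<in>{1..k}. \<sigma> i \<noteq> i \<longrightarrow>
       m i = m (\<sigma> i) \<and> \<alpha> i = inv (\<alpha> (\<sigma> i)) \<and> inv (\<alpha> (\<sigma> i)) = \<alpha> (\<sigma> i) \<and> \<alpha> (\<sigma> i) = id) \<and>
    inflation k \<sigma> m \<alpha> = inflation k \<sigma> m (\<lambda>_. id) \<and>
    (\<forall>i\<in>{1..k}. \<sigma> i = i \<longrightarrow> (\<forall>x\<in>block m i. inflation k \<sigma> m \<alpha> x = x))"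
proof -
  interpret simple_inflation k \<sigma> m \<alpha>
    using assms(1,2,3,5,6,7) by unfold_locales
  have id: "\<alpha> i = id" if "i \<in> {1..k}" for i
    using \<alpha>_id[OF that assms(8)] .
  \<comment> \<open>For a fixed point \<open>i\<close> of \<open>\<sigma>\<close>, the value offset
    and the position offset coincide by \<open>val_offset_eq\<close>.\<close>
  have "\<pi> x = x" if i: "i \<in> {1..k}" "\<sigma> i = i" and x: "x \<in> block m i" for i x
  proof -
    have "x = pos_offset m i + (x - pos_offset m i)" "x - pos_offset m i \<in> {1..m i}"
      using x by (auto simp: block_def)
    then show ?thesis
      using inflation_apply[OF i(1), of "x - pos_offset m i" m \<sigma> \<alpha>] id[OF i(1)] val_offset_eq[OF i(1)] i(2)
      by simp
  qed
  moreover have "\<pi> = inflation k \<sigma> m (\<lambda>_. id)"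
    using id by (rule inflation_cong)
  ultimately show ?thesis using id \<sigma>_in length_\<sigma> by (simp add: inv_id)
qed

end
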